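(* Let $G$ be a graph containing no induced cycle of length $4$, and let $M$ be a module of $G$. Then every minimum interval deletion set $Q$ of $G$ either contains all vertices of $M$, or $Q\cap M$ is a minimum interval deletion set of $G[M]$.
   Context: Graphs are finite, simple, undirected. A module of $G$ is a set $M\subseteq V(G)$ such that every vertex of $M$ has the same neighbors outside $M$. An interval deletion set of a graph $H$ is a set $Q\subseteq V(H)$ such that $H-Q$ is an interval graph; it is minimum if no interval deletion set of $H$ is smaller. *)

theory Defs
  imports Complex_Main "Graph_Theory.Digraph_Component"
begin

text \<open>
  A finite simple undirected graph is an instance of the locale \<^locale>\<open>graph\<close>: a finite
  loop-free digraph without parallel arcs in which every arc has its reverse. Two vertices
  \<open>u\<close>, \<open>v\<close> are adjacent iff \<open>u \<rightarrow>\<^bsub>G\<^esub> v\<close>, and \<open>G[S]\<close> is \<open>G \<restriction> S\<close>, which is meaningful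
  only for \<open>S \<subseteq> verts G\<close>.
\<close>

text \<open>The list \<open>xs\<close> enumerates the vertices in cyclic order.\<close>

definition induced_cycle :: "('a, 'b) pre_digraph \<Rightarrow> 'a list \<Rightarrow> bool" where
  "induced_cycle G xs \<longleftrightarrow>
     3 \<le> length xs \<and> distinct xs \<and> set xs \<subseteq> verts G \<and>
     (\<forall>i < length xs. \<forall>j < length xs.
        xs ! i \<rightarrow>\<^bsub>G\<^esub> xs ! j \<longleftrightarrow>
        j = Suc i mod length xs \<or> i = Suc j mod length xs)"

definition module_of :: "('a, 'b) pre_digraph \<Rightarrow> 'a set \<Rightarrow> bool" where
  "module_of G M \<longleftrightarrow>
     M \<subseteq> verts G \<and>
     (\<forall>u \<in> M. \<forall>v \<in> M. \<forall>x \<in> verts G - M. u \<rightarrow>\<^bsub>G\<^esub> x \<longleftrightarrow> v \<rightarrow>\<^bsub>G\<^esub> x)"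

text \<open>
  Vertices are represented by nonempty closed intervals of the real line. Intervals of distinct
  vertices may coincide.
\<close>

definition interval_graph :: "('a, 'b) pre_digraph \<Rightarrow> bool" where
  "interval_graph G \<longleftrightarrow>
     graph G \<and>
     (\<exists>l r :: 'a \<Rightarrow> real.
        (\<forall>v \<in> verts G. l v \<le> r v) \<and>
        (\<forall>u \<in> verts G. \<forall>v \<in> verts G. u \<noteq> v \<longrightarrow>
           (u \<rightarrow>\<^bsub>G\<^esub> v \<longleftrightarrow> {l u..r u} \<inter> {l v..r v} \<noteq> {})))"

definition interval_deletion_set :: "('a, 'b) pre_digraph \<Rightarrow> 'a set \<Rightarrow> bool" where
  "interval_deletion_set H Q \<longleftrightarrow>
     Q \<subseteq> verts H \<and> interval_graph (H \<restriction> (verts H - Q))"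

definition minimum_interval_deletion_set :: "('a, 'b) pre_digraph \<Rightarrow> 'a set \<Rightarrow> bool" where
  "minimum_interval_deletion_set H Q \<longleftrightarrow>
     interval_deletion_set H Q \<and>
     (\<forall>Q'. interval_deletion_set H Q' \<longrightarrow> card Q \<le> card Q')"

end

theory Submission
  imports Defs
begin

text \<open>
  Let \<open>v\<close> be a vertex of \<open>M - Q\<close>, and let \<open>X\<close> be the set of vertices outside \<open>M \<union> Q\<close>. In an
  interval model of \<open>G[X \<union> {v}]\<close> the vertex \<open>v\<close> can be replaced by any interval graph \<open>G[M']\<close> with
  \<open>M' \<subseteq> M\<close>: since there is no induced 4-cycle, \<open>M\<close> is a clique or its neighbourhood is one. In the
  first case all of \<open>M'\<close> receives the interval of \<open>v\<close>; in the second the intervals of \<open>v\<close> and its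
  neighbours share a point \<open>p\<close>, and after a slight widening of all intervals a tiny model
  of \<open>G[M']\<close> fits in around \<open>p\<close>. Hence the part of \<open>Q\<close> in \<open>M\<close> can be exchanged for any interval
  deletion set of \<open>G[M]\<close>.
\<close>

section \<open>Interval models by endpoint inequalities: gluing, rescaling, gaps\<close>

definition interval_model ::
    "('a \<Rightarrow> 'a \<Rightarrow> bool) \<Rightarrow> 'a set \<Rightarrow> ('a \<Rightarrow> real) \<Rightarrow> ('a \<Rightarrow> real) \<Rightarrow> bool" where
  "interval_model A S l r \<longleftrightarrow>
     (\<forall>v \<in> S. l v \<le> r v) \<and>
     (\<forall>u \<in> S. \<forall>v \<in> S. u \<noteq> v \<longrightarrow> (A u v \<longleftrightarrow> l u \<le> r v \<and> l v \<le> r u))"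

lemma interval_model_le: "interval_model A S l r \<Longrightarrow> v \<in> S \<Longrightarrow> l v \<le> r v"
  by (simp add: interval_model_def)

lemma interval_model_adj:
  "interval_model A S l r \<Longrightarrow> u \<in> S \<Longrightarrow> v \<in> S \<Longrightarrow> u \<noteq> v \<Longrightarrow> A u v \<longleftrightarrow> l u \<le> r v \<and> l v \<le> r u"
  by (simp add: interval_model_def)

lemma interval_model_subset: "interval_model A T l r \<Longrightarrow> S \<subseteq> T \<Longrightarrow> interval_model A S l r"
  unfolding interval_model_def by blast

text \<open>Pairs inside \<open>S\<close> or inside \<open>T\<close> are settled by the given
  models. Adjacency and overlap are both symmetric, so a mixed pair may be oriented to start in
  \<open>T\<close>, where \<open>cross\<close> applies.\<close>

lemma interval_model_Un:
  assumes S: "interval_model A S l r" and T: "interval_model A T l r"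
    and sym: "\<And>x y. A x y \<Longrightarrow> A y x"
    and cross: "\<And>u x. u \<in> T \<Longrightarrow> x \<in> S \<Longrightarrow> u \<notin> S \<Longrightarrow> A u x \<longleftrightarrow> l u \<le> r x \<and> l x \<le> r u"
  shows "interval_model A (S \<union> T) l r"
  unfolding interval_model_def
proof (intro conjI ballI impI)
  fix v assume "v \<in> S \<union> T"
  then show "l v \<le> r v" using S T by (auto dest: interval_model_le)
next
  fix u v assume uv: "u \<in> S \<union> T" "v \<in> S \<union> T" "u \<noteq> v"
  have swap: "A u v \<longleftrightarrow> A v u" using sym by blast
  consider "u \<in> S" "v \<in> S" | "u \<in> T" "v \<in> T" | "u \<in> T" "v \<in> S" "u \<notin> S" | "v \<in> T" "u \<in> S" "v \<notin> S"
    using uv by blast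
  then show "A u v \<longleftrightarrow> l u \<le> r v \<and> l v \<le> r u"
  proof cases
    case 1 then show ?thesis using interval_model_adj[OF S] uv(3) by blast
  next
    case 2 then show ?thesis using interval_model_adj[OF T] uv(3) by blast
  next
    case 3 then show ?thesis by (rule cross)
  next
    case 4 then show ?thesis using cross[of v u] swap by blast
  qed
qed

text \<open>An increasing affine map preserves every comparison of endpoints, hence the model;
  finitely many endpoints are bounded, so such a map can squeeze them all into any window around
  \<open>p\<close>.\<close>

lemma interval_model_rescale:
  assumes "finite S" and m: "interval_model A S l r" and "0 < e"
  obtains l' r' where "interval_model A S l' r'"
    and "\<And>u. u \<in> S \<Longrightarrow> p - e \<le> l' u" and "\<And>u. u \<in> S \<Longrightarrow> r' u \<le> p + e"
proof -
  \<comment> \<open>\<open>B\<close> bounds all endpoints in absolute value, and the summand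
    \<open>1\<close> makes it a valid divisor even if \<open>S\<close> is empty or all endpoints
    vanish. The map \<open>f\<close> below sends \<open>- B\<close> and \<open>B\<close> to the ends
    of the window.\<close>
  define B where "B = 1 + (\<Sum>u\<in>S. \<bar>l u\<bar> + \<bar>r u\<bar>)"
  have B: "0 < B" unfolding B_def by (intro add_pos_nonneg sum_nonneg) auto
  have bd: "\<bar>l u\<bar> + \<bar>r u\<bar> \<le> B" if "u \<in> S" for u
    using member_le_sum[of u S "\<lambda>u. \<bar>l u\<bar> + \<bar>r u\<bar>"] that assms(1) by (simp add: B_def)
  define f where "f t = p + e / B * t" for t
  have k: "0 < e / B" using B assms(3) by simp
  have mono: "f s \<le> f t \<longleftrightarrow> s \<le> t" for s t
    using k by (simp only: f_def add_le_cancel_left mult_le_cancel_left_pos)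
  have fB: "f B = p + e" "f (- B) = p - e" using B by (auto simp: f_def)
  show thesis
  proof (rule that[of "f \<circ> l" "f \<circ> r"])
    show "interval_model A S (f \<circ> l) (f \<circ> r)"
      using m by (simp add: interval_model_def mono)
    show "p - e \<le> (f \<circ> l) u" if "u \<in> S" for u
      using bd[OF that] mono[of "- B" "l u"] fB by simp
    show "(f \<circ> r) u \<le> p + e" if "u \<in> S" for u
      using bd[OF that] mono[of "r u" B] fB by simp
  qed
qed

text \<open>Finitely many positive gaps have a positive minimum. This is the room in which intervals
  can be widened without creating new intersections.\<close>

lemma finite_uniform_gap:
  fixes l r :: "'a \<Rightarrow> real"
  assumes "finite S"
  obtains d where "0 < d"
    and "\<And>u v. u \<in> S \<Longrightarrow> v \<in> S \<Longrightarrow> r v < l u \<Longrightarrow> r v + d \<le> l u"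
proof -
  \<comment> \<open>The element \<open>1\<close> keeps \<open>D\<close> nonempty when no interval
    lies entirely before another.\<close>
  define D where "D = insert 1 ((\<lambda>(u, v). l u - r v) ` {(u, v) \<in> S \<times> S. r v < l u})"
  have "finite {(u, v) \<in> S \<times> S. r v < l u}"
    by (rule finite_subset[of _ "S \<times> S"]) (use assms in auto)
  then have D: "finite D" "D \<noteq> {}" by (auto simp: D_def)
  show thesis
  proof (rule that[of "Min D"])
    show "0 < Min D" using D by (auto simp: D_def)
    show "r v + Min D \<le> l u" if "u \<in> S" "v \<in> S" "r v < l u" for u v
    proof -
      have "l u - r v \<in> D" using that by (auto simp: D_def)
      then have "Min D \<le> l u - r v" using D by simp
      then show ?thesis by simp
    qed
  qed
qed

section \<open>Replacing a vertex of an interval model by a set of its twins\<close>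

lemma interval_model_substitute_clique:
  assumes m: "interval_model A (insert v X) l r" and "v \<notin> X"
    and disj: "X \<inter> M' = {}"
    and sym: "\<And>x y. A x y \<Longrightarrow> A y x"
    and twin: "\<And>u x. u \<in> M' \<Longrightarrow> x \<in> X \<Longrightarrow> A u x \<longleftrightarrow> A v x"
    and clique: "\<And>a b. a \<in> M' \<Longrightarrow> b \<in> M' \<Longrightarrow> a \<noteq> b \<Longrightarrow> A a b"
  shows "\<exists>l r. interval_model A (X \<union> M') l r"
proof -
  define l' where "l' u = (if u \<in> X then l u else l v)" for u
  define r' where "r' u = (if u \<in> X then r u else r v)" for u
  have v: "l v \<le> r v" using interval_model_le[OF m] by blast
  have "interval_model A X l' r'"
    using interval_model_subset[OF m subset_insertI] by (simp add: interval_model_def l'_def r'_def)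
  moreover have "interval_model A M' l' r'"
    using clique disj v by (auto simp: interval_model_def l'_def r'_def)
  moreover have "A u x \<longleftrightarrow> l' u \<le> r' x \<and> l' x \<le> r' u" if "u \<in> M'" "x \<in> X" "u \<notin> X" for u x
    using interval_model_adj[OF m, of v x] twin[OF that(1,2)] that assms(2)
    by (auto simp: l'_def r'_def)
  ultimately show ?thesis using interval_model_Un sym by metis
qed

text \<open>The intervals of \<open>v\<close> and its neighbours meet pairwise, so by the Helly
  property of the line they share a point \<open>p\<close>. The model of \<open>M'\<close> is shrunk
  into a window around \<open>p\<close> that every widened neighbour covers and every widened
  non-neighbour misses.\<close>

lemma interval_model_substitute_clique_neighbourhood:
  assumes m: "interval_model A (insert v X) l r" and "v \<notin> X" and fX: "finite X"
    and m': "interval_model A M' l' r'" and fM: "finite M'"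
    and disj: "X \<inter> M' = {}"
    and sym: "\<And>x y. A x y \<Longrightarrow> A y x"
    and twin: "\<And>u x. u \<in> M' \<Longrightarrow> x \<in> X \<Longrightarrow> A u x \<longleftrightarrow> A v x"
    and clique: "\<And>x y. x \<in> X \<Longrightarrow> y \<in> X \<Longrightarrow> x \<noteq> y \<Longrightarrow> A v x \<Longrightarrow> A v y \<Longrightarrow> A x y"
  shows "\<exists>l r. interval_model A (X \<union> M') l r"
proof -
  define N where "N = insert v {x \<in> X. A v x}"
  \<comment> \<open>Once every left endpoint in \<open>N\<close> is at most every right endpoint in
    \<open>N\<close>, the largest left endpoint lies in all these intervals.\<close>
  define p where "p = Max (l ` N)"
  have N: "finite (l ` N)" "l ` N \<noteq> {}" "N \<subseteq> insert v X" using fX by (auto simp: N_def)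
  have le: "l x \<le> r y" if "x \<in> N" "y \<in> N" for x y
  proof (cases "x = y")
    case True
    then show ?thesis using interval_model_le[OF m] that N(3) by blast
  next
    case False
    then have "A x y" using that clique sym by (auto simp: N_def)
    then show ?thesis using interval_model_adj[OF m, of x y] that N(3) False by blast
  qed
  have lp: "l x \<le> p" if "x \<in> N" for x
    using that N by (simp add: p_def)
  have rp: "p \<le> r x" if "x \<in> N" for x
    using that N le by (auto simp: p_def)
  have vN: "v \<in> N" by (simp add: N_def)
  obtain d where d: "0 < d"
    and gap: "\<And>u w. u \<in> insert v X \<Longrightarrow> w \<in> insert v X \<Longrightarrow> r w < l u \<Longrightarrow> r w + d \<le> l u"
    using finite_uniform_gap[of "insert v X" r l] fX by auto
  \<comment> \<open>Widening two intervals by \<open>e\<close> uses up \<open>2 * e\<close> of a gap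
    of at least \<open>3 * e\<close>, so disjoint ones stay disjoint. Likewise an interval at
    distance at least \<open>3 * e\<close> from \<open>p\<close> stays \<open>2 * e\<close> away
    after widening, outside the window of radius \<open>e\<close>.\<close>
  define e where "e = d / 3"
  have e: "0 < e" "d = 3 * e" using d by (auto simp: e_def)
  obtain lM rM where M: "interval_model A M' lM rM"
    and lM: "\<And>u. u \<in> M' \<Longrightarrow> p - e \<le> lM u" and rM: "\<And>u. u \<in> M' \<Longrightarrow> rM u \<le> p + e"
    using interval_model_rescale[OF fM m' e(1)] by metis
  define L where "L u = (if u \<in> X then l u - e else lM u)" for u
  define R where "R u = (if u \<in> X then r u + e else rM u)" for u
  have LR_X: "L x = l x - e" "R x = r x + e" if "x \<in> X" for x using that by (auto simp: L_def R_def)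
  have LR_M: "L x = lM x" "R x = rM x" if "x \<in> M'" for x using that disj by (auto simp: L_def R_def)
  have widen: "l x - e \<le> r y + e \<longleftrightarrow> l x \<le> r y" if "x \<in> X" "y \<in> X" for x y
    using gap[of x y] that e by fastforce
  have "interval_model A X L R"
    unfolding interval_model_def
  proof (intro conjI ballI impI)
    show "L x \<le> R x" if "x \<in> X" for x
      using interval_model_le[OF m, of x] that e by (simp add: LR_X)
    show "A x y \<longleftrightarrow> L x \<le> R y \<and> L y \<le> R x" if "x \<in> X" "y \<in> X" "x \<noteq> y" for x y
      using interval_model_adj[OF m, of x y] that widen by (simp add: LR_X)
  qed
  moreover have "interval_model A M' L R"
    using M LR_M by (simp add: interval_model_def)
  moreover have "A u x \<longleftrightarrow> L u \<le> R x \<and> L x \<le> R u" if u: "u \<in> M'" and x: "x \<in> X" for u x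
  proof -
    have luru: "lM u \<le> rM u" using interval_model_le[OF M u] .
    show ?thesis
    proof (cases "A v x")
      case True
      then have "x \<in> N" using x by (simp add: N_def)
      \<comment> \<open>The widened interval of \<open>x\<close> contains the whole window from
        \<open>p - e\<close> to \<open>p + e\<close>, hence meets every interval of
        \<open>M'\<close>.\<close>
      then have "l x \<le> p" "p \<le> r x" using lp rp by auto
      then show ?thesis
        using lM[OF u] rM[OF u] luru twin[OF u x] True by (simp add: LR_X[OF x] LR_M[OF u])
    next
      case False
      then consider "r v < l x" | "r x < l v"
        using interval_model_adj[OF m, of v x] x \<open>v \<notin> X\<close> by force
      \<comment> \<open>The interval of \<open>x\<close> is at least \<open>d\<close> away from that
        of \<open>v\<close>, which contains \<open>p\<close>.\<close>
      then have "p + d \<le> l x \<or> r x + d \<le> p"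
        using gap[of x v] gap[of v x] x lp[OF vN] rp[OF vN] by cases auto
      then show ?thesis
        using lM[OF u] rM[OF u] luru twin[OF u x] False e by (auto simp: LR_X[OF x] LR_M[OF u])
    qed
  qed
  ultimately show ?thesis using interval_model_Un sym by metis
qed

section \<open>Induced subgraphs, modules and the absence of induced 4-cycles\<close>

lemma induce_subgraph_dominates:
  "u \<rightarrow>\<^bsub>G \<restriction> S\<^esub> v \<longleftrightarrow> u \<rightarrow>\<^bsub>G\<^esub> v \<and> u \<in> S \<and> v \<in> S"
  by (auto simp: arcs_ends_conv)

lemma induce_subgraph_induce_subgraph: "T \<subseteq> S \<Longrightarrow> (G \<restriction> S) \<restriction> T = G \<restriction> T"
  by (auto simp: induce_subgraph_def)

lemma graph_induce_subgraph:
  assumes "graph G" and "S \<subseteq> verts G"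
  shows "graph (G \<restriction> S)"
proof -
  interpret graph G by fact
  have "induced_subgraph (G \<restriction> S) G" using assms(2) by (rule induced_induce)
  then show ?thesis
    by (metis digraph.graphI digraphI_induced induced_graph_imp_symmetric sym_arcs)
qed

lemma interval_graph_induce_subgraph:
  assumes "graph G" and "S \<subseteq> verts G"
  shows "interval_graph (G \<restriction> S) \<longleftrightarrow> (\<exists>l r. interval_model (\<lambda>u v. u \<rightarrow>\<^bsub>G\<^esub> v) S l r)"
proof -
  have meet: "{a..b} \<inter> {c..d} \<noteq> {} \<longleftrightarrow> a \<le> d \<and> c \<le> b" if "a \<le> b" "c \<le> d" for a b c d :: real
    using that by (auto simp: Int_atLeastAtMost)
  have "(\<forall>v \<in> S. l v \<le> r v) \<and>
        (\<forall>u \<in> S. \<forall>v \<in> S. u \<noteq> v \<longrightarrow> (u \<rightarrow>\<^bsub>G\<^esub> v \<longleftrightarrow> {l u..r u} \<inter> {l v..r v} \<noteq> {})) \<longleftrightarrow>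
      interval_model (\<lambda>u v. u \<rightarrow>\<^bsub>G\<^esub> v) S l r" for l r
    \<comment> \<open>\<open>conj_cong\<close> makes the first conjunct available in the second,
      where \<open>meet\<close> requires nonempty intervals.\<close>
    unfolding interval_model_def by (intro conj_cong refl ball_cong imp_cong) (simp only: meet)
  then show ?thesis
    using graph_induce_subgraph[OF assms]
    by (simp add: interval_graph_def induce_subgraph_dominates)
qed

lemma interval_deletion_set_induce_subgraph:
  assumes "S \<subseteq> verts G"
  shows "interval_deletion_set (G \<restriction> S) Q \<longleftrightarrow> Q \<subseteq> S \<and> interval_graph (G \<restriction> (S - Q))"
  using assms by (auto simp: interval_deletion_set_def induce_subgraph_induce_subgraph)

text \<open>If both alternatives failed, nonadjacent \<open>a\<close>, \<open>b\<close> in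
  \<open>M\<close> and nonadjacent outside neighbours \<open>x\<close>, \<open>y\<close> of
  \<open>v\<close> would form the induced 4-cycle \<open>a\<close>, \<open>x\<close>,
  \<open>b\<close>, \<open>y\<close>, because all of \<open>M\<close> has the same neighbours
  outside.\<close>

lemma module_clique_or_clique_neighbourhood:
  assumes "graph G" and C4: "\<not> (\<exists>xs. induced_cycle G xs \<and> length xs = 4)"
    and M: "module_of G M" and v: "v \<in> M"
  obtains "\<And>a b. a \<in> M \<Longrightarrow> b \<in> M \<Longrightarrow> a \<noteq> b \<Longrightarrow> a \<rightarrow>\<^bsub>G\<^esub> b"
  | "\<And>x y. x \<in> verts G - M \<Longrightarrow> y \<in> verts G - M \<Longrightarrow> x \<noteq> y \<Longrightarrow>
       v \<rightarrow>\<^bsub>G\<^esub> x \<Longrightarrow> v \<rightarrow>\<^bsub>G\<^esub> y \<Longrightarrow> x \<rightarrow>\<^bsub>G\<^esub> y"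
proof -
  interpret graph G by fact
  have sym: "x \<rightarrow>\<^bsub>G\<^esub> y \<Longrightarrow> y \<rightarrow>\<^bsub>G\<^esub> x" for x y by (rule arcs_ends_symmetric[OF sym_arcs])
  have irrefl: "\<not> x \<rightarrow>\<^bsub>G\<^esub> x" for x using adj_not_same by blast
  have False
    if ab: "a \<in> M" "b \<in> M" "a \<noteq> b" "\<not> a \<rightarrow>\<^bsub>G\<^esub> b"
      and xy: "x \<in> verts G - M" "y \<in> verts G - M" "x \<noteq> y" "v \<rightarrow>\<^bsub>G\<^esub> x" "v \<rightarrow>\<^bsub>G\<^esub> y" "\<not> x \<rightarrow>\<^bsub>G\<^esub> y"
    for a b x y
  proof -
    have adj: "c \<rightarrow>\<^bsub>G\<^esub> x" "c \<rightarrow>\<^bsub>G\<^esub> y" if "c \<in> M" for c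
      using M v that xy unfolding module_of_def by blast+
    have E: "a \<rightarrow>\<^bsub>G\<^esub> x" "x \<rightarrow>\<^bsub>G\<^esub> a" "a \<rightarrow>\<^bsub>G\<^esub> y" "y \<rightarrow>\<^bsub>G\<^esub> a" "b \<rightarrow>\<^bsub>G\<^esub> x" "x \<rightarrow>\<^bsub>G\<^esub> b" "b \<rightarrow>\<^bsub>G\<^esub> y" "y \<rightarrow>\<^bsub>G\<^esub> b"
      "\<not> b \<rightarrow>\<^bsub>G\<^esub> a" "\<not> y \<rightarrow>\<^bsub>G\<^esub> x"
      using adj ab xy sym by blast+
    have ne: "a \<noteq> x" "a \<noteq> y" "b \<noteq> x" "b \<noteq> y" using ab xy by auto
    have V: "a \<in> verts G" "b \<in> verts G" "x \<in> verts G" "y \<in> verts G"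
      using M ab xy by (auto simp: module_of_def)
    have "induced_cycle G [a, x, b, y]"
      unfolding induced_cycle_def
      by (simp add: All_less_Suc V E ne ab xy irrefl ne[symmetric])
    then show False using C4 by force
  qed
  then show thesis using that by blast
qed

text \<open>The vertex \<open>v\<close> only marks the place of the module in a model of the rest.
  Since \<open>M'\<close> is chosen independently of \<open>v\<close>, the survivors of any deletion
  set of \<open>G[M]\<close> can be inserted there.\<close>

lemma interval_graph_substitute_module:
  assumes G: "graph G" and C4: "\<not> (\<exists>xs. induced_cycle G xs \<and> length xs = 4)"
    and M: "module_of G M" and v: "v \<in> M"
    and X: "X \<subseteq> verts G - M" and M': "M' \<subseteq> M"
    and iX: "interval_graph (G \<restriction> insert v X)" and iM: "interval_graph (G \<restriction> M')"
  shows "interval_graph (G \<restriction> (X \<union> M'))"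
proof -
  interpret graph G by fact
  let ?A = "\<lambda>u v. u \<rightarrow>\<^bsub>G\<^esub> v"
  have sym: "x \<rightarrow>\<^bsub>G\<^esub> y \<Longrightarrow> y \<rightarrow>\<^bsub>G\<^esub> x" for x y by (rule arcs_ends_symmetric[OF sym_arcs])
  have MG: "M \<subseteq> verts G" using M by (simp add: module_of_def)
  have fin: "finite X" "finite M'"
    using X M' MG by (auto intro: finite_subset[OF _ finite_verts])
  have sub: "insert v X \<subseteq> verts G" "M' \<subseteq> verts G" "X \<union> M' \<subseteq> verts G" using X M' MG v by auto
  obtain l r where m: "interval_model ?A (insert v X) l r"
    using iX interval_graph_induce_subgraph[OF G sub(1)] by blast
  obtain l' r' where m': "interval_model ?A M' l' r'"
    using iM interval_graph_induce_subgraph[OF G sub(2)] by blast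
  have vX: "v \<notin> X" and disj: "X \<inter> M' = {}" using X v M' by auto
  have twin: "u \<rightarrow>\<^bsub>G\<^esub> x \<longleftrightarrow> v \<rightarrow>\<^bsub>G\<^esub> x" if "u \<in> M'" "x \<in> X" for u x
    using M v X M' that unfolding module_of_def by blast
  have "\<exists>l r. interval_model ?A (X \<union> M') l r"
    using G C4 M v
  proof (cases rule: module_clique_or_clique_neighbourhood)
    case 1
    then have "\<And>a b. a \<in> M' \<Longrightarrow> b \<in> M' \<Longrightarrow> a \<noteq> b \<Longrightarrow> a \<rightarrow>\<^bsub>G\<^esub> b" using M' by blast
    then show ?thesis using interval_model_substitute_clique[OF m vX disj sym twin] by blast
  next
    case 2
    then have "\<And>x y. x \<in> X \<Longrightarrow> y \<in> X \<Longrightarrow> x \<noteq> y \<Longrightarrow> v \<rightarrow>\<^bsub>G\<^esub> x \<Longrightarrow> v \<rightarrow>\<^bsub>G\<^esub> y \<Longrightarrow> x \<rightarrow>\<^bsub>G\<^esub> y"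
      using X by blast
    then show ?thesis
      using interval_model_substitute_clique_neighbourhood[OF m vX fin(1) m' fin(2) disj sym twin]
      by blast
  qed
  then show ?thesis using interval_graph_induce_subgraph[OF G sub(3)] by blast
qed

section \<open>Exchanging the part of a deletion set inside the module\<close>

lemma interval_graph_induce_subgraph_mono:
  assumes "graph G" and "T \<subseteq> verts G" and "S \<subseteq> T" and "interval_graph (G \<restriction> T)"
  shows "interval_graph (G \<restriction> S)"
  using assms interval_graph_induce_subgraph[of G T] interval_graph_induce_subgraph[of G S]
    interval_model_subset
  by (metis order_trans)

theorem theorem4p5:
  fixes G :: "('a, 'b) pre_digraph" and M Q :: "'a set"
  assumes "graph G"
    and "\<not> (\<exists>xs. induced_cycle G xs \<and> length xs = 4)"
    and "module_of G M"
    and "minimum_interval_deletion_set G Q"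
  shows "M \<subseteq> Q \<or> minimum_interval_deletion_set (G \<restriction> M) (Q \<inter> M)"
proof (cases "M \<subseteq> Q")
  case False
  then obtain v where v: "v \<in> M" "v \<notin> Q" by blast
  interpret graph G by fact
  have MG: "M \<subseteq> verts G" using assms(3) by (simp add: module_of_def)
  have QG: "Q \<subseteq> verts G" and iQ: "interval_graph (G \<restriction> (verts G - Q))"
    and min: "\<And>Q'. interval_deletion_set G Q' \<Longrightarrow> card Q \<le> card Q'"
    using assms(4) by (auto simp: minimum_interval_deletion_set_def interval_deletion_set_def)
  have restr: "interval_graph (G \<restriction> S)" if "S \<subseteq> verts G - Q" for S
    using interval_graph_induce_subgraph_mono[OF assms(1) Diff_subset that iQ] .
  have "interval_deletion_set (G \<restriction> M) (Q \<inter> M)"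
    using restr[of "M - Q \<inter> M"] MG
    by (auto simp: interval_deletion_set_induce_subgraph[OF MG])
  moreover have "card (Q \<inter> M) \<le> card Q'" if Q': "interval_deletion_set (G \<restriction> M) Q'" for Q'
  proof -
    have Q'M: "Q' \<subseteq> M" and iQ': "interval_graph (G \<restriction> (M - Q'))"
      using Q' interval_deletion_set_induce_subgraph[OF MG] by auto
    \<comment> \<open>As \<open>v\<close> survives the deletion of \<open>Q\<close>, it can
      represent \<open>M\<close> next to the surviving vertices outside \<open>M\<close>.\<close>
    have "interval_graph (G \<restriction> insert v (verts G - M - Q))"
      using v MG by (intro restr) auto
    from interval_graph_substitute_module[OF assms(1-3) v(1) _ _ this iQ']
    have "interval_graph (G \<restriction> ((verts G - M - Q) \<union> (M - Q')))" by blast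
    \<comment> \<open>The substituted graph is what remains of \<open>G\<close> when
      \<open>Q \<inter> M\<close> is exchanged for \<open>Q'\<close>, so the minimality of
      \<open>Q\<close> applies to \<open>(Q - M) \<union> Q'\<close>.\<close>
    also have "(verts G - M - Q) \<union> (M - Q') = verts G - ((Q - M) \<union> Q')"
      using MG Q'M by blast
    finally have "card Q \<le> card ((Q - M) \<union> Q')"
      using MG QG Q'M by (intro min) (auto simp: interval_deletion_set_def)
    also have "\<dots> \<le> card (Q - M) + card Q'" by (rule card_Un_le)
    \<comment> \<open>Splitting \<open>card Q\<close> along \<open>M\<close> lets the summand
      \<open>card (Q - M)\<close> cancel.\<close>
    finally show ?thesis
      using card_Int_Diff[of Q M] finite_subset[OF QG finite_verts] by simp
  qed
  ultimately show ?thesis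
    by (simp add: minimum_interval_deletion_set_def)
qed simp

end
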